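(* If $G=(V,E)$ is a median graph, then the best constant $K^*$ associated with its Fermat $3$-distance $d_{\mathbf{m}}$ is equal to $\frac12$. Moreover, the only Fermat point of $\{u,v,w\}$ is $\mathbf{m}(u,v,w)$ (for any $u,v,w\in V$).
   Context: A median graph is a connected undirected simple graph $G=(V,E)$ in which, for any triplet of vertices $u,v,w$, there is one and only one vertex, denoted $\mathbf{m}(u,v,w)$, that is at the intersection of shortest paths between any two elements among $u,v,w$. Let $d$ be the usual (shortest-path) distance between vertices of $G$. The Fermat $3$-distance of $G$ is the function $d_{\mathbf{m}}\colon V^3\to[0,+\infty[$ defined by $d_{\mathbf{m}}(u,v,w)=\min_{y\in V}\big(d(u,y)+d(v,y)+d(w,y)\big)$. A Fermat point of $\{u,v,w\}$ is a vertex $y\in V$ at which the sum $d(u,y)+d(v,y)+d(w,y)$ attains its minimum over $V$. The best constant $K^*$ associated with $d_{\mathbf{m}}$ is the infimum of the set of real numbers $K\in\,]0,1]$ such that $d_{\mathbf{m}}(u,v,w)\leq K\big(d_{\mathbf{m}}(z,v,w)+d_{\mathbf{m}}(u,z,w)+d_{\mathbf{m}}(u,v,z)\big)$ for all $u,v,w,z\in V$.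
   Formalization: The claim that K* equals 1/2 is stated for median graphs with at least two vertices; on the one-vertex graph d_m is identically 0, every K in ]0,1] is admissible, and K* = 0. *)

theory Defs
  imports "Graph_Theory.Graph_Theory"
begin

text \<open>
  An undirected simple graph is a symmetric digraph without loops and parallel arcs, each
  edge being a pair of opposite arcs. The locale \<open>graph\<close> of the library is not used
  because it demands finiteness. Connectedness entails that the vertex set is nonempty.
\<close>
locale connected_simple_graph =
  loopfree_digraph G + nomulti_digraph G + sym_digraph G for G :: "('a, 'b) pre_digraph" (structure) +
  assumes connected: "Digraph_Component.connected G"

context wf_digraph begin

definition graph_dist :: "'a \<Rightarrow> 'a \<Rightarrow> real" where
  "graph_dist u v = real_of_ereal (\<mu> (\<lambda>_. 1) u v)"

definition shortest_path :: "'a \<Rightarrow> 'b awalk \<Rightarrow> 'a \<Rightarrow> bool" where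
  "shortest_path u p v \<longleftrightarrow> apath u p v \<and> real (length p) = graph_dist u v"

definition on_shortest_path :: "'a \<Rightarrow> 'a \<Rightarrow> 'a \<Rightarrow> bool" where
  "on_shortest_path u v x \<longleftrightarrow> (\<exists>p. shortest_path u p v \<and> x \<in> set (awalk_verts u p))"

definition is_median :: "'a \<Rightarrow> 'a \<Rightarrow> 'a \<Rightarrow> 'a \<Rightarrow> bool" where
  "is_median u v w x \<longleftrightarrow>
    on_shortest_path u v x \<and> on_shortest_path v w x \<and> on_shortest_path u w x"

definition median :: "'a \<Rightarrow> 'a \<Rightarrow> 'a \<Rightarrow> 'a" where
  "median u v w = (THE x. is_median u v w x)"

definition dist_sum :: "'a \<Rightarrow> 'a \<Rightarrow> 'a \<Rightarrow> 'a \<Rightarrow> real" where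
  "dist_sum u v w y = graph_dist u y + graph_dist v y + graph_dist w y"

text \<open>On a connected graph the infimum is a minimum, see \<open>fermat_dist_attained\<close> below.\<close>
definition fermat_dist :: "'a \<Rightarrow> 'a \<Rightarrow> 'a \<Rightarrow> real" where
  "fermat_dist u v w = (INF y\<in>verts G. dist_sum u v w y)"

definition is_fermat_point :: "'a \<Rightarrow> 'a \<Rightarrow> 'a \<Rightarrow> 'a \<Rightarrow> bool" where
  "is_fermat_point u v w y \<longleftrightarrow>
    y \<in> verts G \<and> (\<forall>x\<in>verts G. dist_sum u v w y \<le> dist_sum u v w x)"

end

locale median_graph = connected_simple_graph +
  assumes ex1_median:
    "\<lbrakk>u \<in> verts G; v \<in> verts G; w \<in> verts G\<rbrakk> \<Longrightarrow> \<exists>!x. is_median u v w x"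

definition best_constant :: "'a set \<Rightarrow> ('a \<Rightarrow> 'a \<Rightarrow> 'a \<Rightarrow> real) \<Rightarrow> real" where
  "best_constant V D = Inf {K. 0 < K \<and> K \<le> 1 \<and>
     (\<forall>u\<in>V. \<forall>v\<in>V. \<forall>w\<in>V. \<forall>z\<in>V. D u v w \<le> K * (D z v w + D u z w + D u v z))}"

context connected_simple_graph begin

lemma verts_nonempty: "verts G \<noteq> {}"
  using connected by (auto simp: connected_def strongly_connected_def)

lemma reachable_verts: "u \<in> verts G \<Longrightarrow> v \<in> verts G \<Longrightarrow> u \<rightarrow>\<^sup>* v"
  using symmetric_connected_imp_strongly_connected[OF sym_arcs connected]
  by (auto simp: strongly_connected_def)

lemma ex_shortest_path:
  assumes "u \<in> verts G" "v \<in> verts G"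
  shows "\<exists>p. shortest_path u p v"
proof -
  have cost: "awalk_cost (\<lambda>_. 1) q = real (length q)" for q :: "'b list"
    by (induct q) auto
  have no_neg_cycle: "\<not> (\<exists>w c. awalk w c w \<and> w \<in> set (awalk_verts u q) \<and> awalk_cost (\<lambda>_. 1) c < 0)" for q
    by (simp add: cost)
  obtain p0 where "apath u p0 v"
    using reachable_verts[OF assms] by (auto simp: reachable_apath)
  then obtain p where p: "apath u p v"
      and least: "\<And>q. apath u q v \<Longrightarrow> length p \<le> length q"
    using ex_has_least_nat[of "\<lambda>q. apath u q v" p0 length] by blast
  have "length p \<le> length q" if "awalk u q v" for q
  proof -
    have "length (awalk_to_apath q) \<le> length q"
      using awalk_to_path_no_neg_cyc_cost[OF that no_neg_cycle] by (simp add: cost)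
    with least[OF apath_awalk_to_apath[OF that]] show ?thesis by linarith
  qed
  then have "\<mu> (\<lambda>_. 1) u v = ereal (length p)"
    unfolding \<mu>_def cost using p by (intro antisym INF_greatest INF_lower) (auto simp: apath_def)
  with p show ?thesis by (auto simp: shortest_path_def graph_dist_def)
qed

lemma fermat_dist_attained:
  assumes "u \<in> verts G" "v \<in> verts G" "w \<in> verts G"
  shows "\<exists>y. is_fermat_point u v w y \<and> fermat_dist u v w = dist_sum u v w y"
proof -
  have nat: "\<exists>n. graph_dist a b = real n" if "a \<in> verts G" "b \<in> verts G" for a b
    using ex_shortest_path[OF that] by (auto simp: shortest_path_def) metis
  have "\<exists>n. dist_sum u v w y = real n" if "y \<in> verts G" for y
    unfolding dist_sum_def using nat[OF assms(1) that] nat[OF assms(2) that] nat[OF assms(3) that]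
    by (metis of_nat_add)
  then obtain f where f: "\<And>y. y \<in> verts G \<Longrightarrow> dist_sum u v w y = real (f y)" by metis
  obtain y where y: "y \<in> verts G" "\<And>x. x \<in> verts G \<Longrightarrow> f y \<le> f x"
    using verts_nonempty ex_has_least_nat[of "\<lambda>x. x \<in> verts G" _ f] by blast
  then have le: "dist_sum u v w y \<le> dist_sum u v w x" if "x \<in> verts G" for x
    using f that by simp
  then have "fermat_dist u v w = dist_sum u v w y"
    unfolding fermat_dist_def using y(1) by (intro cInf_eq_minimum) auto
  with y(1) le show ?thesis by (auto simp: is_fermat_point_def)
qed

end

end

theory Submission
  imports Defs
begin

text \<open>
  Write \<open>d\<close> for the graph distance. A vertex \<open>y\<close> lies on a shortest path from \<open>u\<close> to \<open>v\<close> if and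
  only if the triangle inequality \<open>d u v \<le> d u y + d y v\<close> is an equality
  (\<open>on_shortest_path_iff\<close>). Adding the triangle inequalities at \<open>y\<close> for the three pairs taken from
  \<open>u, v, w\<close> shows that \<open>d u y + d v y + d w y\<close> is never smaller than half the perimeter
  \<open>d u v + d v w + d u w\<close>, and that it is equal to it exactly when all three inequalities are tight,
  that is, when \<open>y\<close> is a median of \<open>u, v, w\<close> (\<open>dist_sum_eq_half_perimeter_iff\<close>). Since the median
  exists, the lower bound is attained: the Fermat points are the medians, hence there is exactly one
  of them, and the Fermat distance is half the perimeter.

  With this formula the constant is elementary. Let \<open>P = d u v + d v w + d u w\<close> and
  \<open>S = d u z + d v z + d w z\<close>. The three Fermat distances that involve \<open>z\<close> sum up to \<open>S + P/2\<close>,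
  while \<open>P/2 \<le> S\<close>, so their sum is at least \<open>P\<close>, twice the Fermat distance of \<open>u, v, w\<close>; thus
  \<open>K = 1/2\<close> is admissible. Conversely, for \<open>z = w = u \<noteq> v\<close> the inequality reads
  \<open>d u v \<le> K * (2 * d u v)\<close>, which forces \<open>K \<ge> 1/2\<close>. This is where two distinct vertices are needed:
  on a single vertex both sides vanish for
  every \<open>K\<close>.
\<close>

section \<open>Graph distance and geodesics\<close>

text \<open>
  The distance is an infimum in the extended reals converted to a real, and the conversion sends
  infinite values to \<open>0\<close>; the point is that in the presence of a walk the infimum is finite.
\<close>
lemma (in wf_digraph) graph_dist_le_length:
  assumes "awalk u p v"
  shows "graph_dist u v \<le> real (length p)"
proof -
  have cost: "awalk_cost (\<lambda>_. 1) q = real (length q)" for q :: "'b list"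
    by (induct q) auto
  have "\<mu> (\<lambda>_. 1) u v \<le> ereal (length p)"
    unfolding \<mu>_def using assms by (intro INF_lower2[of p]) (auto simp: cost)
  moreover have "0 \<le> \<mu> (\<lambda>_. 1) u v"
    unfolding \<mu>_def by (intro INF_greatest) (auto simp: cost)
  ultimately show ?thesis
    unfolding graph_dist_def by (cases "\<mu> (\<lambda>_. 1) u v") auto
qed

lemma (in sym_digraph) awalk_reverse:
  assumes "awalk u p v"
  shows "\<exists>q. awalk v q u \<and> length q = length p"
  using assms
proof (induct p arbitrary: u)
  case Nil
  then show ?case by (auto simp: awalk_Nil_iff intro: exI[of _ "[]"])
next
  case (Cons e p)
  then obtain q where q: "awalk v q (head G e)" "length q = length p"
    by (auto simp: awalk_Cons_iff)
  have e: "e \<in> arcs G" "u = tail G e"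
    using Cons.prems by (auto simp: awalk_Cons_iff)
  then obtain e' where e': "e' \<in> arcs G" "tail G e' = head G e" "head G e' = u"
    using sym_arcs by (auto simp: symmetric_conv)
  have "awalk v (q @ [e']) u"
    using awalk_appendI[OF q(1)] arc_implies_awalk[OF e'(1)] e' by simp
  with q(2) show ?case by (intro exI[of _ "q @ [e']"]) simp
qed

text \<open>
  A walk of minimal length repeats no vertex, since cutting out a closed part would shorten it.
\<close>
lemma (in wf_digraph) shortest_pathI:
  assumes walk: "awalk u p v" and len: "real (length p) \<le> graph_dist u v"
  shows "shortest_path u p v"
proof -
  have "distinct (awalk_verts u p)"
  proof (rule ccontr)
    assume "\<not> distinct (awalk_verts u p)"
    then obtain q r s w where split: "p = q @ r @ s" "0 < length r" "awalk u q w" "awalk w s v"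
      using awalk_not_distinct_decomp[OF walk] by blast
    then have "graph_dist u v \<le> real (length (q @ s))"
      by (intro graph_dist_le_length awalk_appendI)
    moreover have "length (q @ s) < length p"
      using split(1,2) by simp
    ultimately show False
      using len by linarith
  qed
  with walk len graph_dist_le_length[OF walk] show ?thesis
    by (auto simp: shortest_path_def apath_def)
qed

context connected_simple_graph begin

lemma ex_walk_of_dist:
  assumes "u \<in> verts G" "v \<in> verts G"
  obtains p where "awalk u p v" "real (length p) = graph_dist u v"
  using ex_shortest_path[OF assms] by (auto simp: shortest_path_def dest: awalkI_apath)

lemma graph_dist_self: "u \<in> verts G \<Longrightarrow> graph_dist u u = 0"
  using graph_dist_le_length[of u "[]" u] ex_walk_of_dist[of u u]
  by (metis awalk_Nil_iff le_zero_eq list.size(3) of_nat_0 of_nat_le_iff)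

lemma graph_dist_pos:
  assumes "u \<in> verts G" "v \<in> verts G" "u \<noteq> v"
  shows "0 < graph_dist u v"
proof -
  obtain p where p: "awalk u p v" "real (length p) = graph_dist u v"
    using ex_walk_of_dist assms by blast
  with assms(3) have "p \<noteq> []" by (auto simp: awalk_Nil_iff)
  then have "0 < real (length p)" by simp
  with p(2) show ?thesis by simp
qed

lemma graph_dist_sym:
  assumes "u \<in> verts G" "v \<in> verts G"
  shows "graph_dist u v = graph_dist v u"
proof -
  have "graph_dist b a \<le> graph_dist a b" if "a \<in> verts G" "b \<in> verts G" for a b
    using ex_walk_of_dist[OF that] awalk_reverse graph_dist_le_length by metis
  with assms show ?thesis by (intro antisym)
qed

lemma graph_dist_triangle:
  assumes "u \<in> verts G" "x \<in> verts G" "v \<in> verts G"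
  shows "graph_dist u v \<le> graph_dist u x + graph_dist x v"
proof -
  obtain p where p: "awalk u p x" "real (length p) = graph_dist u x"
    using ex_walk_of_dist assms(1,2) by blast
  obtain q where q: "awalk x q v" "real (length q) = graph_dist x v"
    using ex_walk_of_dist assms(2,3) by blast
  show ?thesis
    using graph_dist_le_length[OF awalk_appendI[OF p(1) q(1)]] p(2) q(2) by simp
qed

text \<open>
  Cutting a shortest path at one of its vertices gives two walks whose lengths add up to its length.
  Conversely, gluing two shortest paths whose lengths add up to \<open>graph_dist u v\<close> gives a walk of
  minimal length.
\<close>
lemma on_shortest_path_iff:
  assumes u: "u \<in> verts G" and v: "v \<in> verts G"
  shows "on_shortest_path u v x \<longleftrightarrow>
    x \<in> verts G \<and> graph_dist u x + graph_dist x v = graph_dist u v"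
proof
  assume "on_shortest_path u v x"
  then obtain p where p: "awalk u p v" "real (length p) = graph_dist u v"
      and x: "x \<in> set (awalk_verts u p)"
    by (auto simp: on_shortest_path_def shortest_path_def dest: awalkI_apath)
  obtain q r where qr: "p = q @ r" "awalk u q x" "awalk x r v"
    using awalk_decomp[OF p(1) x] by blast
  have xG: "x \<in> verts G"
    using qr(2) by (rule awalk_last_in_verts)
  have "graph_dist u x + graph_dist x v \<le> graph_dist u v"
    using graph_dist_le_length[OF qr(2)] graph_dist_le_length[OF qr(3)] p(2) qr(1) by simp
  with xG graph_dist_triangle[OF u xG v]
  show "x \<in> verts G \<and> graph_dist u x + graph_dist x v = graph_dist u v" by simp
next
  assume x: "x \<in> verts G \<and> graph_dist u x + graph_dist x v = graph_dist u v"
  obtain p where p: "awalk u p x" "real (length p) = graph_dist u x"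
    using ex_walk_of_dist u x by blast
  obtain q where q: "awalk x q v" "real (length q) = graph_dist x v"
    using ex_walk_of_dist v x by blast
  have "shortest_path u (p @ q) v"
    using awalk_appendI[OF p(1) q(1)] p(2) q(2) x by (intro shortest_pathI) auto
  moreover have "x \<in> set (awalk_verts u (p @ q))"
    using set_awalk_verts_append[OF p(1) q(1)] hd_in_awalk_verts(1)[OF q(1)] by blast
  ultimately show "on_shortest_path u v x" by (auto simp: on_shortest_path_def)
qed

section \<open>Fermat points and medians\<close>

lemma half_perimeter_le_dist_sum:
  assumes "u \<in> verts G" "v \<in> verts G" "w \<in> verts G" "y \<in> verts G"
  shows "(graph_dist u v + graph_dist v w + graph_dist u w) / 2 \<le> dist_sum u v w y"
  using graph_dist_triangle[of u y v] graph_dist_triangle[of v y w] graph_dist_triangle[of u y w]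
    graph_dist_sym[of v y] graph_dist_sym[of w y] assms
  by (simp add: dist_sum_def)

text \<open>
  Twice the distance sum is the sum of the three detours through \<open>y\<close>, so it reaches the perimeter
  only if none of the detours is longer than the direct distance.
\<close>
lemma dist_sum_eq_half_perimeter_iff:
  assumes "u \<in> verts G" "v \<in> verts G" "w \<in> verts G" "y \<in> verts G"
  shows "dist_sum u v w y = (graph_dist u v + graph_dist v w + graph_dist u w) / 2
    \<longleftrightarrow> is_median u v w y"
proof -
  have sym: "graph_dist y v = graph_dist v y" "graph_dist y w = graph_dist w y"
    using graph_dist_sym assms by auto
  have tri: "graph_dist u v \<le> graph_dist u y + graph_dist v y"
      "graph_dist v w \<le> graph_dist v y + graph_dist w y"
      "graph_dist u w \<le> graph_dist u y + graph_dist w y"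
    using graph_dist_triangle[of u y v] graph_dist_triangle[of v y w]
      graph_dist_triangle[of u y w] assms by (simp_all add: sym)
  have "is_median u v w y \<longleftrightarrow> graph_dist u y + graph_dist v y = graph_dist u v \<and>
      graph_dist v y + graph_dist w y = graph_dist v w \<and>
      graph_dist u y + graph_dist w y = graph_dist u w"
    using assms by (simp add: is_median_def on_shortest_path_iff sym)
  with tri show ?thesis
    unfolding dist_sum_def by argo
qed

end

context median_graph begin

lemma median_is_median:
  assumes "u \<in> verts G" "v \<in> verts G" "w \<in> verts G"
  shows "is_median u v w (median u v w)"
  unfolding median_def using ex1_median[OF assms] by (rule theI')

lemma median_in_verts:
  assumes "u \<in> verts G" "v \<in> verts G" "w \<in> verts G"
  shows "median u v w \<in> verts G"
  using median_is_median[OF assms] on_shortest_path_iff[OF assms(1,2)]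
  by (auto simp: is_median_def)

lemma dist_sum_median:
  assumes "u \<in> verts G" "v \<in> verts G" "w \<in> verts G"
  shows "dist_sum u v w (median u v w) = (graph_dist u v + graph_dist v w + graph_dist u w) / 2"
  using dist_sum_eq_half_perimeter_iff[OF assms median_in_verts[OF assms]]
    median_is_median[OF assms] by simp

lemma is_fermat_point_iff:
  assumes "u \<in> verts G" "v \<in> verts G" "w \<in> verts G"
  shows "is_fermat_point u v w y \<longleftrightarrow> y = median u v w"
proof
  assume y: "is_fermat_point u v w y"
  then have yG: "y \<in> verts G" by (simp add: is_fermat_point_def)
  have "dist_sum u v w y \<le> dist_sum u v w (median u v w)"
    using y median_in_verts[OF assms] by (simp add: is_fermat_point_def)
  then have "dist_sum u v w y = (graph_dist u v + graph_dist v w + graph_dist u w) / 2"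
    using dist_sum_median[OF assms] half_perimeter_le_dist_sum[OF assms yG] by simp
  then have "is_median u v w y"
    using dist_sum_eq_half_perimeter_iff[OF assms yG] by simp
  with median_is_median[OF assms] ex1_median[OF assms] show "y = median u v w" by blast
next
  assume "y = median u v w"
  then show "is_fermat_point u v w y"
    using median_in_verts[OF assms] half_perimeter_le_dist_sum[OF assms]
    by (simp add: is_fermat_point_def dist_sum_median[OF assms])
qed

lemma fermat_dist_eq_half_perimeter:
  assumes "u \<in> verts G" "v \<in> verts G" "w \<in> verts G"
  shows "fermat_dist u v w = (graph_dist u v + graph_dist v w + graph_dist u w) / 2"
  using fermat_dist_attained[OF assms] is_fermat_point_iff[OF assms] dist_sum_median[OF assms]
  by auto

section \<open>The best constant\<close>

lemma fermat_dist_le_half_sum: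
  assumes "u \<in> verts G" "v \<in> verts G" "w \<in> verts G" "z \<in> verts G"
  shows "fermat_dist u v w \<le>
    1 / 2 * (fermat_dist z v w + fermat_dist u z w + fermat_dist u v z)"
  using half_perimeter_le_dist_sum[OF assms] assms
    graph_dist_sym[of z v] graph_dist_sym[of z w]
  by (simp add: fermat_dist_eq_half_perimeter dist_sum_def field_simps)

lemma best_constant_fermat_dist:
  assumes "u \<in> verts G" "v \<in> verts G" "u \<noteq> v"
  shows "best_constant (verts G) fermat_dist = 1 / 2"
  unfolding best_constant_def
proof (rule cInf_eq_minimum, goal_cases)
  case 1
  then show ?case using fermat_dist_le_half_sum by simp
next
  case (2 K)
  \<comment> \<open>The instance \<open>w = z = u\<close>: the term in which \<open>z\<close> replaces \<open>v\<close> vanishes, the other two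
    are equal to the left-hand side.\<close>
  then have "fermat_dist u v u \<le> K * (fermat_dist u v u + fermat_dist u u u + fermat_dist u v u)"
    using assms by blast
  moreover have "fermat_dist u v u = graph_dist u v" "fermat_dist u u u = 0"
    using assms graph_dist_sym[of v u]
    by (simp_all add: fermat_dist_eq_half_perimeter graph_dist_self)
  ultimately have "graph_dist u v * 1 \<le> graph_dist u v * (2 * K)"
    by (simp add: algebra_simps)
  then have "1 \<le> 2 * K"
    using graph_dist_pos[OF assms] by (simp only: mult_le_cancel_left_pos)
  then show ?case by simp
qed

end

theorem proposition3p5:
  fixes G :: "('a, 'b) pre_digraph"
  assumes "median_graph G"
  shows "((\<exists>u\<in>verts G. \<exists>v\<in>verts G. u \<noteq> v) \<longrightarrow>
           best_constant (verts G) (wf_digraph.fermat_dist G) = 1 / 2) \<and>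
         (\<forall>u\<in>verts G. \<forall>v\<in>verts G. \<forall>w\<in>verts G.
           {y. wf_digraph.is_fermat_point G u v w y} = {wf_digraph.median G u v w})"
proof -
  interpret median_graph G by (fact assms)
  show ?thesis
    using best_constant_fermat_dist is_fermat_point_iff by blast
qed

end
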